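(* For a monoidal coalgebra modality $(!,\delta,\varepsilon,\Delta,\mathsf{e},\mathsf{m},\mathsf{m}_I)$ (equivalently, an additive bialgebra modality or a monoidal bialgebra modality) on an additive symmetric monoidal category, if a codereliction exists, then it is unique.
   Context: Conventions: composition is written diagrammatically, $f;g$ means first $f$ then $g$. Symmetric monoidal categories are taken to be strict, with product $\otimes$, unit $I$, symmetry $\sigma_{A,B}:A\otimes B\to B\otimes A$. Additive category: each homset is a commutative monoid $(+,0)$ with $f;(g+h)=f;g+f;h$, $f;0=0$, $(g+h);k=g;k+h;k$, $0;k=0$. Additive symmetric monoidal category: a symmetric monoidal category that is additive and satisfies $f\otimes(g+h)=f\otimes g+f\otimes h$, $f\otimes 0=0$, $(g+h)\otimes k=g\otimes k+h\otimes k$, $0\otimes k=0$. Coalgebra modality $(!,\delta,\varepsilon,\Delta,\mathsf{e})$: a comonad $(!,\delta,\varepsilon)$, with $\delta_A:!(A)\to!!(A)$, $\varepsilon_A:!(A)\to A$, together with natural transformations $\Delta_A:!(A)\to!(A)\otimes!(A)$, $\mathsf{e}_A:!(A)\to I$ such that each $(!(A),\Delta_A,\mathsf{e}_A)$ is a cocommutative comonoid and $\delta_A$ is a comonoid morphism: $\delta_A;\Delta_{!(A)}=\Delta_A;(\delta_A\otimes\delta_A)$, $\delta_A;\mathsf{e}_{!(A)}=\mathsf{e}_A$. Monoidal coalgebra modality $(!,\delta,\varepsilon,\Delta,\mathsf{e},\mathsf{m},\mathsf{m}_I)$: a coalgebra modality with a natural transformation $\mathsf{m}_{A,B}:!(A)\otimes!(B)\to!(A\otimes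 B)$ and a map $\mathsf{m}_I:I\to!(I)$ making $!$ a symmetric (lax) monoidal endofunctor, such that - $\mathsf{m}_{A,B};\delta_{A\otimes B}=(\delta_A\otimes\delta_B);\mathsf{m}_{!(A),!(B)};!(\mathsf{m}_{A,B})$, $\mathsf{m}_I;\delta_I=\mathsf{m}_I;!(\mathsf{m}_I)$, $\mathsf{m}_{A,B};\varepsilon_{A\otimes B}=\varepsilon_A\otimes\varepsilon_B$, $\mathsf{m}_I;\varepsilon_I=1_I$; - $\mathsf{m}_{A,B};\Delta_{A\otimes B}=(\Delta_A\otimes\Delta_B);(1\otimes\sigma_{!(A),!(B)}\otimes1);(\mathsf{m}_{A,B}\otimes\mathsf{m}_{A,B})$, $\mathsf{m}_{A,B};\mathsf{e}_{A\otimes B}=\mathsf{e}_A\otimes\mathsf{e}_B$, $\mathsf{m}_I;\Delta_I=\mathsf{m}_I\otimes\mathsf{m}_I$, $\mathsf{m}_I;\mathsf{e}_I=1_I$; - $\delta_A;!(\Delta_A)=\Delta_A;(\delta_A\otimes\delta_A);\mathsf{m}_{!(A),!(A)}$, $\delta_A;!(\mathsf{e}_A)=\mathsf{e}_A;\mathsf{m}_I$. Bialgebra modality $(!,\delta,\varepsilon,\Delta,\mathsf{e},\nabla,\mathsf{u})$: a coalgebra modality with natural transformations $\nabla_A:!(A)\otimes!(A)\to!(A)$, $\mathsf{u}_A:I\to!(A)$ such that each $(!(A),\nabla_A,\mathsf{u}_A)$ is a commutative monoid and $(!(A),\nabla_A,\mathsf{u}_A,\Delta_A,\mathsf{e}_A)$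 is a bimonoid. On an additive symmetric monoidal category it is called additive if $\nabla_A;\varepsilon_A=(\mathsf{e}_A\otimes\varepsilon_A)+(\varepsilon_A\otimes\mathsf{e}_A)$, $\mathsf{u}_A;\varepsilon_A=0$, $!(f+g)=\Delta_A;(!(f)\otimes!(g));\nabla_B$ and $!(0)=\mathsf{e}_A;\mathsf{u}_B$ for all $f,g:A\to B$ and $0:A\to B$. Monoidal bialgebra modality $(!,\delta,\varepsilon,\Delta,\mathsf{e},\mathsf{m},\mathsf{m}_I,\nabla,\mathsf{u})$: both a monoidal coalgebra modality and a bialgebra modality (on the same coalgebra modality) such that - $(1_{!(A)}\otimes\nabla_B);\mathsf{m}_{A,B}=(\Delta_A\otimes1\otimes1);(1\otimes\sigma_{!(A),!(B)}\otimes1);(\mathsf{m}_{A,B}\otimes\mathsf{m}_{A,B});\nabla_{A\otimes B}$; - $(\nabla_A\otimes1_{!(B)});\mathsf{m}_{A,B}=(1\otimes1\otimes\Delta_B);(1\otimes\sigma_{!(A),!(B)}\otimes1);(\mathsf{m}_{A,B}\otimes\mathsf{m}_{A,B});\nabla_{A\otimes B}$; - $(\mathsf{u}_A\otimes1_{!(B)});\mathsf{m}_{A,B}=\mathsf{e}_B;\mathsf{u}_{A\otimes B}$, $(1_{!(A)}\otimes\mathsf{u}_B);\mathsf{m}_{A,B}=\mathsf{e}_A;\mathsf{u}_{A\otimes B}$; - $\nabla_A;\delta_A=(\delta_A\otimes\delta_A);\mathsf{m}_{!(A),!(A)};!(\nabla_A)$, $\mathsf{u}_A;\delta_A=\mathsf{m}_I;!(\mathsf{u}_A)$.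 On an additive symmetric monoidal category these three notions correspond bijectively (keeping the underlying coalgebra modality fixed); a monoidal coalgebra modality has induced $\nabla_A:=(\delta_A\otimes\delta_A);\mathsf{m}_{!(A),!(A)};!\big((\varepsilon_A\otimes\mathsf{e}_A)+(\mathsf{e}_A\otimes\varepsilon_A)\big)$ and $\mathsf{u}_A:=\mathsf{m}_I;!(0)$ with $0:I\to A$. Codereliction for a monoidal coalgebra modality on an additive symmetric monoidal category: a natural transformation $\eta_A:A\to!(A)$ such that, with $\nabla,\mathsf{u}$ as just induced, $\eta_A;\varepsilon_A=1_A$; $(\eta_A\otimes1_{!(B)});\mathsf{m}_{A,B}=(1_A\otimes\varepsilon_B);\eta_{A\otimes B}$; $(1_{!(A)}\otimes\eta_B);\mathsf{m}_{A,B}=(\varepsilon_A\otimes1_B);\eta_{A\otimes B}$; $\eta_A;\mathsf{e}_A=0$; $\eta_A;\Delta_A=(\eta_A\otimes\mathsf{u}_A)+(\mathsf{u}_A\otimes\eta_A)$; and $\eta_A;\delta_A=(\mathsf{u}_A\otimes\eta_A);(\delta_A\otimes\eta_{!(A)});\nabla_{!(A)}$. *)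

theory Defs
  imports Main
begin

text \<open>
  Composition is diagrammatic: \<open>f ;; g\<close> is first \<open>f\<close>, then \<open>g\<close>. Objects and arrows
  range over whole types, so two families of arrows indexed by the objects agree exactly
  when they are equal as functions. The operations \<open>;;\<close> and \<open>\<oplus>\<close> are total functions,
  constrained only on composable, respectively parallel, arrows.
  Binding strength: \<open>\<otimes>\<close> over \<open>;;\<close> over \<open>\<oplus>\<close>.
\<close>

record ('o, 'a) smc =
  source :: "'a \<Rightarrow> 'o"
  target :: "'a \<Rightarrow> 'o"
  ident :: "'o \<Rightarrow> 'a" ("\<one>\<index>")
  seq :: "'a \<Rightarrow> 'a \<Rightarrow> 'a" (infixl ";;\<index>" 70)
  unit_ob :: "'o" ("\<I>\<index>")
  tensor_ob :: "'o \<Rightarrow> 'o \<Rightarrow> 'o" (infixl "\<odot>\<index>" 75)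
  tensor :: "'a \<Rightarrow> 'a \<Rightarrow> 'a" (infixl "\<otimes>\<index>" 75)
  symm :: "'o \<Rightarrow> 'o \<Rightarrow> 'a" ("\<sigma>\<index>")

record ('o, 'a) additive_smc = "('o, 'a) smc" +
  plus_arr :: "'a \<Rightarrow> 'a \<Rightarrow> 'a" (infixl "\<oplus>\<index>" 65)
  zero_arr :: "'o \<Rightarrow> 'o \<Rightarrow> 'a" ("\<zero>\<index>")

definition hom :: "('o, 'a, 'x) smc_scheme \<Rightarrow> 'o \<Rightarrow> 'o \<Rightarrow> 'a set"
  where "hom C A B = {f. source C f = A \<and> target C f = B}"

locale category =
  fixes C :: "('o, 'a, 'x) smc_scheme" (structure)
  assumes ident_hom: "\<one> A \<in> hom C A A"
    and seq_hom: "\<lbrakk>f \<in> hom C A B; g \<in> hom C B D\<rbrakk> \<Longrightarrow> f ;; g \<in> hom C A D"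
    and ident_seq: "f \<in> hom C A B \<Longrightarrow> \<one> A ;; f = f"
    and seq_ident: "f \<in> hom C A B \<Longrightarrow> f ;; \<one> B = f"
    and seq_assoc: "\<lbrakk>f \<in> hom C A B; g \<in> hom C B D; h \<in> hom C D E\<rbrakk>
      \<Longrightarrow> f ;; g ;; h = f ;; (g ;; h)"

text \<open>Strict symmetric monoidal categories.\<close>

locale symmetric_monoidal_category = category C
  for C :: "('o, 'a, 'x) smc_scheme" (structure) +
  assumes tensor_ob_assoc: "A \<odot> B \<odot> D = A \<odot> (B \<odot> D)"
    and unit_tensor_ob: "\<I> \<odot> A = A"
    and tensor_ob_unit: "A \<odot> \<I> = A"
    and tensor_hom: "\<lbrakk>f \<in> hom C A B; g \<in> hom C A' B'\<rbrakk> \<Longrightarrow> f \<otimes> g \<in> hom C (A \<odot> A') (B \<odot> B')"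
    and tensor_ident: "\<one> A \<otimes> \<one> B = \<one> (A \<odot> B)"
    and interchange: "\<lbrakk>f \<in> hom C A B; g \<in> hom C B D; f' \<in> hom C A' B'; g' \<in> hom C B' D'\<rbrakk>
      \<Longrightarrow> (f ;; g) \<otimes> (f' ;; g') = f \<otimes> f' ;; g \<otimes> g'"
    and tensor_assoc: "f \<otimes> g \<otimes> h = f \<otimes> (g \<otimes> h)"
    and unit_tensor: "\<one> \<I> \<otimes> f = f"
    and tensor_unit: "f \<otimes> \<one> \<I> = f"
    and symm_hom: "\<sigma> A B \<in> hom C (A \<odot> B) (B \<odot> A)"
    and symm_nat: "\<lbrakk>f \<in> hom C A B; g \<in> hom C A' B'\<rbrakk> \<Longrightarrow> f \<otimes> g ;; \<sigma> B B' = \<sigma> A A' ;; g \<otimes> f"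
    and symm_inv: "\<sigma> A B ;; \<sigma> B A = \<one> (A \<odot> B)"
    and symm_hexagon: "\<sigma> A (B \<odot> D) = \<sigma> A B \<otimes> \<one> D ;; \<one> B \<otimes> \<sigma> A D"

locale additive_symmetric_monoidal_category = symmetric_monoidal_category C
  for C :: "('o, 'a, 'x) additive_smc_scheme" (structure) +
  assumes plus_hom: "\<lbrakk>f \<in> hom C A B; g \<in> hom C A B\<rbrakk> \<Longrightarrow> f \<oplus> g \<in> hom C A B"
    and zero_hom: "\<zero> A B \<in> hom C A B"
    and plus_assoc: "\<lbrakk>f \<in> hom C A B; g \<in> hom C A B; h \<in> hom C A B\<rbrakk>
      \<Longrightarrow> f \<oplus> g \<oplus> h = f \<oplus> (g \<oplus> h)"
    and plus_comm: "\<lbrakk>f \<in> hom C A B; g \<in> hom C A B\<rbrakk> \<Longrightarrow> f \<oplus> g = g \<oplus> f"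
    and zero_plus: "f \<in> hom C A B \<Longrightarrow> \<zero> A B \<oplus> f = f"
    and seq_plus: "\<lbrakk>f \<in> hom C A B; g \<in> hom C B D; h \<in> hom C B D\<rbrakk>
      \<Longrightarrow> f ;; (g \<oplus> h) = f ;; g \<oplus> f ;; h"
    and seq_zero: "f \<in> hom C A B \<Longrightarrow> f ;; \<zero> B D = \<zero> A D"
    and plus_seq: "\<lbrakk>g \<in> hom C A B; h \<in> hom C A B; k \<in> hom C B D\<rbrakk>
      \<Longrightarrow> (g \<oplus> h) ;; k = g ;; k \<oplus> h ;; k"
    and zero_seq: "k \<in> hom C B D \<Longrightarrow> \<zero> A B ;; k = \<zero> A D"
    and tensor_plus: "\<lbrakk>f \<in> hom C A B; g \<in> hom C A' B'; h \<in> hom C A' B'\<rbrakk>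
      \<Longrightarrow> f \<otimes> (g \<oplus> h) = f \<otimes> g \<oplus> f \<otimes> h"
    and tensor_zero: "f \<in> hom C A B \<Longrightarrow> f \<otimes> \<zero> A' B' = \<zero> (A \<odot> A') (B \<odot> B')"
    and plus_tensor: "\<lbrakk>g \<in> hom C A B; h \<in> hom C A B; k \<in> hom C A' B'\<rbrakk>
      \<Longrightarrow> (g \<oplus> h) \<otimes> k = g \<otimes> k \<oplus> h \<otimes> k"
    and zero_tensor: "k \<in> hom C A' B' \<Longrightarrow> \<zero> A B \<otimes> k = \<zero> (A \<odot> A') (B \<odot> B')"

text \<open>The endofunctor \<open>!\<close> is \<open>T\<close> on objects and \<open>F\<close> on arrows.\<close>

locale coalgebra_modality = symmetric_monoidal_category C
  for C :: "('o, 'a, 'x) smc_scheme" (structure) +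
  fixes T :: "'o \<Rightarrow> 'o" and F :: "'a \<Rightarrow> 'a"
    and \<delta> \<epsilon> \<Delta> e :: "'o \<Rightarrow> 'a"
  assumes F_hom: "f \<in> hom C A B \<Longrightarrow> F f \<in> hom C (T A) (T B)"
    and F_ident: "F (\<one> A) = \<one> (T A)"
    and F_seq: "\<lbrakk>f \<in> hom C A B; g \<in> hom C B D\<rbrakk> \<Longrightarrow> F (f ;; g) = F f ;; F g"
    and \<delta>_hom: "\<delta> A \<in> hom C (T A) (T (T A))"
    and \<delta>_nat: "f \<in> hom C A B \<Longrightarrow> F f ;; \<delta> B = \<delta> A ;; F (F f)"
    and \<epsilon>_hom: "\<epsilon> A \<in> hom C (T A) A"
    and \<epsilon>_nat: "f \<in> hom C A B \<Longrightarrow> F f ;; \<epsilon> B = \<epsilon> A ;; f"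
    and \<delta>_\<epsilon>: "\<delta> A ;; \<epsilon> (T A) = \<one> (T A)"
    and \<delta>_F_\<epsilon>: "\<delta> A ;; F (\<epsilon> A) = \<one> (T A)"
    and \<delta>_\<delta>: "\<delta> A ;; \<delta> (T A) = \<delta> A ;; F (\<delta> A)"
    and \<Delta>_hom: "\<Delta> A \<in> hom C (T A) (T A \<odot> T A)"
    and \<Delta>_nat: "f \<in> hom C A B \<Longrightarrow> F f ;; \<Delta> B = \<Delta> A ;; F f \<otimes> F f"
    and e_hom: "e A \<in> hom C (T A) \<I>"
    and e_nat: "f \<in> hom C A B \<Longrightarrow> F f ;; e B = e A"
    and \<Delta>_coassoc: "\<Delta> A ;; \<Delta> A \<otimes> \<one> (T A) = \<Delta> A ;; \<one> (T A) \<otimes> \<Delta> A"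
    and \<Delta>_counit_left: "\<Delta> A ;; e A \<otimes> \<one> (T A) = \<one> (T A)"
    and \<Delta>_counit_right: "\<Delta> A ;; \<one> (T A) \<otimes> e A = \<one> (T A)"
    and \<Delta>_cocomm: "\<Delta> A ;; \<sigma> (T A) (T A) = \<Delta> A"
    and \<delta>_\<Delta>: "\<delta> A ;; \<Delta> (T A) = \<Delta> A ;; \<delta> A \<otimes> \<delta> A"
    and \<delta>_e: "\<delta> A ;; e (T A) = e A"

locale monoidal_coalgebra_modality = coalgebra_modality C T F \<delta> \<epsilon> \<Delta> e
  for C :: "('o, 'a, 'x) smc_scheme" (structure)
    and T :: "'o \<Rightarrow> 'o" and F :: "'a \<Rightarrow> 'a"
    and \<delta> \<epsilon> \<Delta> e :: "'o \<Rightarrow> 'a" +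
  fixes m :: "'o \<Rightarrow> 'o \<Rightarrow> 'a" and m\<^sub>I :: "'a"
  assumes m_hom: "m A B \<in> hom C (T A \<odot> T B) (T (A \<odot> B))"
    and m_nat: "\<lbrakk>f \<in> hom C A B; g \<in> hom C A' B'\<rbrakk>
      \<Longrightarrow> F f \<otimes> F g ;; m B B' = m A A' ;; F (f \<otimes> g)"
    and mI_hom: "m\<^sub>I \<in> hom C \<I> (T \<I>)"
    and m_assoc: "m A B \<otimes> \<one> (T D) ;; m (A \<odot> B) D = \<one> (T A) \<otimes> m B D ;; m A (B \<odot> D)"
    and m_unit_left: "m\<^sub>I \<otimes> \<one> (T A) ;; m \<I> A = \<one> (T A)"
    and m_unit_right: "\<one> (T A) \<otimes> m\<^sub>I ;; m A \<I> = \<one> (T A)"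
    and m_symm: "\<sigma> (T A) (T B) ;; m B A = m A B ;; F (\<sigma> A B)"
    and m_\<delta>: "m A B ;; \<delta> (A \<odot> B) = \<delta> A \<otimes> \<delta> B ;; m (T A) (T B) ;; F (m A B)"
    and mI_\<delta>: "m\<^sub>I ;; \<delta> \<I> = m\<^sub>I ;; F m\<^sub>I"
    and m_\<epsilon>: "m A B ;; \<epsilon> (A \<odot> B) = \<epsilon> A \<otimes> \<epsilon> B"
    and mI_\<epsilon>: "m\<^sub>I ;; \<epsilon> \<I> = \<one> \<I>"
    and m_\<Delta>: "m A B ;; \<Delta> (A \<odot> B)
      = \<Delta> A \<otimes> \<Delta> B ;; \<one> (T A) \<otimes> \<sigma> (T A) (T B) \<otimes> \<one> (T B) ;; m A B \<otimes> m A B"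
    and m_e: "m A B ;; e (A \<odot> B) = e A \<otimes> e B"
    and mI_\<Delta>: "m\<^sub>I ;; \<Delta> \<I> = m\<^sub>I \<otimes> m\<^sub>I"
    and mI_e: "m\<^sub>I ;; e \<I> = \<one> \<I>"
    and \<delta>_F_\<Delta>: "\<delta> A ;; F (\<Delta> A) = \<Delta> A ;; \<delta> A \<otimes> \<delta> A ;; m (T A) (T A)"
    and \<delta>_F_e: "\<delta> A ;; F (e A) = e A ;; m\<^sub>I"

locale bialgebra_modality = coalgebra_modality C T F \<delta> \<epsilon> \<Delta> e
  for C :: "('o, 'a, 'x) smc_scheme" (structure)
    and T :: "'o \<Rightarrow> 'o" and F :: "'a \<Rightarrow> 'a"
    and \<delta> \<epsilon> \<Delta> e :: "'o \<Rightarrow> 'a" +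
  fixes nab :: "'o \<Rightarrow> 'a" ("\<nabla>") and u :: "'o \<Rightarrow> 'a"
  assumes nab_hom: "\<nabla> A \<in> hom C (T A \<odot> T A) (T A)"
    and nab_nat: "f \<in> hom C A B \<Longrightarrow> F f \<otimes> F f ;; \<nabla> B = \<nabla> A ;; F f"
    and u_hom: "u A \<in> hom C \<I> (T A)"
    and u_nat: "f \<in> hom C A B \<Longrightarrow> u A ;; F f = u B"
    and nab_assoc: "\<nabla> A \<otimes> \<one> (T A) ;; \<nabla> A = \<one> (T A) \<otimes> \<nabla> A ;; \<nabla> A"
    and nab_unit_left: "u A \<otimes> \<one> (T A) ;; \<nabla> A = \<one> (T A)"
    and nab_unit_right: "\<one> (T A) \<otimes> u A ;; \<nabla> A = \<one> (T A)"
    and nab_comm: "\<sigma> (T A) (T A) ;; \<nabla> A = \<nabla> A"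
    and nab_\<Delta>: "\<nabla> A ;; \<Delta> A
      = \<Delta> A \<otimes> \<Delta> A ;; \<one> (T A) \<otimes> \<sigma> (T A) (T A) \<otimes> \<one> (T A) ;; \<nabla> A \<otimes> \<nabla> A"
    and nab_e: "\<nabla> A ;; e A = e A \<otimes> e A"
    and u_\<Delta>: "u A ;; \<Delta> A = u A \<otimes> u A"
    and u_e: "u A ;; e A = \<one> \<I>"

locale additive_bialgebra_modality =
  additive_symmetric_monoidal_category C + bialgebra_modality C T F \<delta> \<epsilon> \<Delta> e nab u
  for C :: "('o, 'a, 'x) additive_smc_scheme" (structure)
    and T :: "'o \<Rightarrow> 'o" and F :: "'a \<Rightarrow> 'a"
    and \<delta> \<epsilon> \<Delta> e :: "'o \<Rightarrow> 'a"
    and nab :: "'o \<Rightarrow> 'a" ("\<nabla>") and u :: "'o \<Rightarrow> 'a" +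
  assumes nab_\<epsilon>: "\<nabla> A ;; \<epsilon> A = e A \<otimes> \<epsilon> A \<oplus> \<epsilon> A \<otimes> e A"
    and u_\<epsilon>: "u A ;; \<epsilon> A = \<zero> \<I> A"
    and F_plus: "\<lbrakk>f \<in> hom C A B; g \<in> hom C A B\<rbrakk> \<Longrightarrow> F (f \<oplus> g) = \<Delta> A ;; F f \<otimes> F g ;; \<nabla> B"
    and F_zero: "F (\<zero> A B) = e A ;; u B"

locale monoidal_bialgebra_modality =
  monoidal_coalgebra_modality C T F \<delta> \<epsilon> \<Delta> e m m\<^sub>I + bialgebra_modality C T F \<delta> \<epsilon> \<Delta> e nab u
  for C :: "('o, 'a, 'x) smc_scheme" (structure)
    and T :: "'o \<Rightarrow> 'o" and F :: "'a \<Rightarrow> 'a"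
    and \<delta> \<epsilon> \<Delta> e :: "'o \<Rightarrow> 'a"
    and m :: "'o \<Rightarrow> 'o \<Rightarrow> 'a" and m\<^sub>I :: "'a"
    and nab :: "'o \<Rightarrow> 'a" ("\<nabla>") and u :: "'o \<Rightarrow> 'a" +
  assumes nab_m_right: "\<one> (T A) \<otimes> \<nabla> B ;; m A B
      = \<Delta> A \<otimes> \<one> (T B) \<otimes> \<one> (T B) ;; \<one> (T A) \<otimes> \<sigma> (T A) (T B) \<otimes> \<one> (T B)
        ;; m A B \<otimes> m A B ;; \<nabla> (A \<odot> B)"
    and nab_m_left: "\<nabla> A \<otimes> \<one> (T B) ;; m A B
      = \<one> (T A) \<otimes> \<one> (T A) \<otimes> \<Delta> B ;; \<one> (T A) \<otimes> \<sigma> (T A) (T B) \<otimes> \<one> (T B)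
        ;; m A B \<otimes> m A B ;; \<nabla> (A \<odot> B)"
    and u_m_left: "u A \<otimes> \<one> (T B) ;; m A B = e B ;; u (A \<odot> B)"
    and u_m_right: "\<one> (T A) \<otimes> u B ;; m A B = e A ;; u (A \<odot> B)"
    and nab_\<delta>: "\<nabla> A ;; \<delta> A = \<delta> A \<otimes> \<delta> A ;; m (T A) (T A) ;; F (\<nabla> A)"
    and u_\<delta>: "u A ;; \<delta> A = m\<^sub>I ;; F (u A)"

text \<open>
  The multiplication and unit induced by a monoidal coalgebra modality on an additive
  symmetric monoidal category.
\<close>

definition induced_mult ::
  "('o, 'a, 'x) additive_smc_scheme \<Rightarrow> ('o \<Rightarrow> 'o) \<Rightarrow> ('a \<Rightarrow> 'a) \<Rightarrow> ('o \<Rightarrow> 'a) \<Rightarrow> ('o \<Rightarrow> 'a) \<Rightarrow>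
    ('o \<Rightarrow> 'a) \<Rightarrow> ('o \<Rightarrow> 'o \<Rightarrow> 'a) \<Rightarrow> 'o \<Rightarrow> 'a"
  where "induced_mult C T F \<delta> \<epsilon> e m A =
    \<delta> A \<otimes>\<^bsub>C\<^esub> \<delta> A ;;\<^bsub>C\<^esub> m (T A) (T A) ;;\<^bsub>C\<^esub> F (\<epsilon> A \<otimes>\<^bsub>C\<^esub> e A \<oplus>\<^bsub>C\<^esub> e A \<otimes>\<^bsub>C\<^esub> \<epsilon> A)"

definition induced_unit ::
  "('o, 'a, 'x) additive_smc_scheme \<Rightarrow> ('a \<Rightarrow> 'a) \<Rightarrow> 'a \<Rightarrow> 'o \<Rightarrow> 'a"
  where "induced_unit C F m\<^sub>I A = m\<^sub>I ;;\<^bsub>C\<^esub> F (\<zero>\<^bsub>C\<^esub> \<I>\<^bsub>C\<^esub> A)"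

text \<open>
  The codereliction axioms, for an arbitrary choice of the monoidal structure \<open>m\<close> and of the
  multiplication and unit \<open>\<nabla>, u\<close> occurring in them; the three notions of codereliction
  below differ only in where these come from.
\<close>

locale codereliction_laws =
  fixes C :: "('o, 'a, 'x) additive_smc_scheme" (structure)
    and T :: "'o \<Rightarrow> 'o" and F :: "'a \<Rightarrow> 'a"
    and \<delta> \<epsilon> \<Delta> e :: "'o \<Rightarrow> 'a"
    and m :: "'o \<Rightarrow> 'o \<Rightarrow> 'a"
    and nab :: "'o \<Rightarrow> 'a" ("\<nabla>") and u :: "'o \<Rightarrow> 'a"
    and \<eta> :: "'o \<Rightarrow> 'a"
  assumes \<eta>_hom: "\<eta> A \<in> hom C A (T A)"
    and \<eta>_nat: "f \<in> hom C A B \<Longrightarrow> f ;; \<eta> B = \<eta> A ;; F f"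
    and \<eta>_\<epsilon>: "\<eta> A ;; \<epsilon> A = \<one> A"
    and \<eta>_m_left: "\<eta> A \<otimes> \<one> (T B) ;; m A B = \<one> A \<otimes> \<epsilon> B ;; \<eta> (A \<odot> B)"
    and \<eta>_m_right: "\<one> (T A) \<otimes> \<eta> B ;; m A B = \<epsilon> A \<otimes> \<one> B ;; \<eta> (A \<odot> B)"
    and \<eta>_e: "\<eta> A ;; e A = \<zero> A \<I>"
    and \<eta>_\<Delta>: "\<eta> A ;; \<Delta> A = \<eta> A \<otimes> u A \<oplus> u A \<otimes> \<eta> A"
    and \<eta>_\<delta>: "\<eta> A ;; \<delta> A = u A \<otimes> \<eta> A ;; \<delta> A \<otimes> \<eta> (T A) ;; \<nabla> (T A)"

definition codereliction ::
  "('o, 'a, 'x) additive_smc_scheme \<Rightarrow> ('o \<Rightarrow> 'o) \<Rightarrow> ('a \<Rightarrow> 'a) \<Rightarrow> ('o \<Rightarrow> 'a) \<Rightarrow> ('o \<Rightarrow> 'a) \<Rightarrow>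
    ('o \<Rightarrow> 'a) \<Rightarrow> ('o \<Rightarrow> 'a) \<Rightarrow> ('o \<Rightarrow> 'o \<Rightarrow> 'a) \<Rightarrow> 'a \<Rightarrow> ('o \<Rightarrow> 'a) \<Rightarrow> bool"
  where "codereliction C T F \<delta> \<epsilon> \<Delta> e m m\<^sub>I \<eta> \<longleftrightarrow>
    codereliction_laws C T F \<delta> \<epsilon> \<Delta> e m (induced_mult C T F \<delta> \<epsilon> e m) (induced_unit C F m\<^sub>I) \<eta>"

text \<open>
  An additive bialgebra modality carries no \<open>m, m\<^sub>I\<close> of its own; a codereliction for it is a
  codereliction for the corresponding monoidal coalgebra modality, that is, the one on the same
  coalgebra modality whose induced multiplication and unit are the given ones.
\<close>

definition additive_bialgebra_codereliction ::
  "('o, 'a, 'x) additive_smc_scheme \<Rightarrow> ('o \<Rightarrow> 'o) \<Rightarrow> ('a \<Rightarrow> 'a) \<Rightarrow> ('o \<Rightarrow> 'a) \<Rightarrow> ('o \<Rightarrow> 'a) \<Rightarrow>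
    ('o \<Rightarrow> 'a) \<Rightarrow> ('o \<Rightarrow> 'a) \<Rightarrow> ('o \<Rightarrow> 'a) \<Rightarrow> ('o \<Rightarrow> 'a) \<Rightarrow> ('o \<Rightarrow> 'a) \<Rightarrow> bool"
  where "additive_bialgebra_codereliction C T F \<delta> \<epsilon> \<Delta> e nab u \<eta> \<longleftrightarrow>
    (\<exists>m m\<^sub>I. monoidal_coalgebra_modality C T F \<delta> \<epsilon> \<Delta> e m m\<^sub>I \<and>
      nab = induced_mult C T F \<delta> \<epsilon> e m \<and> u = induced_unit C F m\<^sub>I \<and>
      codereliction C T F \<delta> \<epsilon> \<Delta> e m m\<^sub>I \<eta>)"

text \<open>
  For a monoidal bialgebra modality all of \<open>m, \<nabla>, u\<close> are part of the structure, and a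
  codereliction is one for the given \<open>m, \<nabla>, u\<close>.
\<close>

definition monoidal_bialgebra_codereliction ::
  "('o, 'a, 'x) additive_smc_scheme \<Rightarrow> ('o \<Rightarrow> 'o) \<Rightarrow> ('a \<Rightarrow> 'a) \<Rightarrow> ('o \<Rightarrow> 'a) \<Rightarrow> ('o \<Rightarrow> 'a) \<Rightarrow>
    ('o \<Rightarrow> 'a) \<Rightarrow> ('o \<Rightarrow> 'a) \<Rightarrow> ('o \<Rightarrow> 'o \<Rightarrow> 'a) \<Rightarrow> ('o \<Rightarrow> 'a) \<Rightarrow> ('o \<Rightarrow> 'a) \<Rightarrow> ('o \<Rightarrow> 'a) \<Rightarrow> bool"
  where "monoidal_bialgebra_codereliction C T F \<delta> \<epsilon> \<Delta> e m nab u \<eta> \<longleftrightarrow>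
    codereliction_laws C T F \<delta> \<epsilon> \<Delta> e m nab u \<eta>"

end

theory Submission
  imports Defs
begin

text \<open>
  Over a fixed family \<open>m\<close>, two coderelictions \<open>\<eta>\<close> and \<open>\<eta>'\<close> agree because both monoidal
  laws evaluate the same arrow \<open>\<eta>' A \<otimes> \<eta> \<I> ;; m A \<I>\<close>: the law of \<open>\<eta>\<close> in the right argument together
  with \<open>\<eta>' A ;; \<epsilon> A = \<one> A\<close> turns it into \<open>\<eta> A\<close>, and the law of \<open>\<eta>'\<close> in the left argument together
  with \<open>\<eta> \<I> ;; \<epsilon> \<I> = \<one> \<I>\<close> turns it into \<open>\<eta>' A\<close> (\<open>codereliction_unique\<close>). This settles monoidal
  coalgebra modalities and monoidal bialgebra modalities, where \<open>m\<close> is given.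

  For an additive bialgebra modality the two coderelictions may a priori refer to different
  families \<open>m\<close> inducing the given \<open>\<nabla>\<close>, so one also has to see that \<open>\<nabla>\<close> and \<open>u\<close> determine \<open>m\<close>.
  The arrow \<open>\<gamma> = \<delta> A \<otimes> \<delta> B ;; m (T A) (T B)\<close> is a coalgebra structure on \<open>T A \<odot> T B\<close>, and
  \<open>m A B = \<gamma> ;; F (\<epsilon> A \<otimes> \<epsilon> B)\<close> is the extension of \<open>\<epsilon> A \<otimes> \<epsilon> B\<close> to a coalgebra map into the
  cofree coalgebra on \<open>A \<odot> B\<close>.

  From \<open>\<nabla>\<close>, \<open>u\<close> and the coalgebra modality one builds an arrow \<open>collect A B : T A \<odot> T B \<rightarrow> T (T A \<odot> T B)\<close>, which
  multiplies the two insertions of \<open>T A\<close> and \<open>T B\<close> into \<open>T A \<odot> T B\<close> given by \<open>u\<close>, and an arrow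
  \<open>separate A B : T (T A \<odot> T B) \<rightarrow> A \<odot> B\<close>, which duplicates its input and projects one copy
  to \<open>A\<close> and the other one to \<open>B\<close>. An induced \<open>\<nabla>\<close> is a map of coalgebras, hence so is
  \<open>collect A B\<close>. The bimonoid law and the formula for \<open>\<nabla> ;; \<epsilon>\<close> as a sum give
  \<open>collect A B ;; separate A B = \<epsilon> A \<otimes> \<epsilon> B\<close>. Therefore
  \<open>collect A B ;; \<delta> (T A \<odot> T B) ;; F (separate A B) = \<gamma> ;; F (collect A B ;; separate A B) = m A B\<close>,
  where the left hand side does not mention \<open>m\<close> (\<open>m_eq_collect_separate\<close>).
\<close>

section \<open>Typing by source and target\<close>

text \<open>
  Restating the typing rules and the categorical laws in terms of sources and targets leaves
  only equations between objects as side conditions, which the simplifier decides.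
\<close>

context category
begin

lemma source_hom: "f \<in> hom C A B \<Longrightarrow> source C f = A"
  and target_hom: "f \<in> hom C A B \<Longrightarrow> target C f = B"
  by (simp_all add: hom_def)

lemma typing_ident [simp]: "source C (\<one> A) = A" "target C (\<one> A) = A"
  using ident_hom by (auto simp: hom_def)

lemma typing_seq [simp]:
  assumes "target C f = source C g"
  shows "source C (f ;; g) = source C f" "target C (f ;; g) = target C g"
  using seq_hom[of f "source C f" "source C g" g "target C g"] assms by (auto simp: hom_def)

lemma ident_seq' [simp]: "source C f = A \<Longrightarrow> \<one> A ;; f = f"
  by (rule ident_seq) (simp add: hom_def)

lemma seq_ident' [simp]: "target C f = A \<Longrightarrow> f ;; \<one> A = f"
  by (rule seq_ident) (simp add: hom_def)

lemma seq_assoc':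
  "\<lbrakk>target C f = source C g; target C g = source C h\<rbrakk> \<Longrightarrow> f ;; g ;; h = f ;; (g ;; h)"
  by (rule seq_assoc) (simp_all add: hom_def)

end

context symmetric_monoidal_category
begin

lemmas strict_ob [simp] = tensor_ob_assoc unit_tensor_ob tensor_ob_unit
lemmas strict_unit [simp] = unit_tensor tensor_unit

lemma typing_tensor [simp]:
  "source C (f \<otimes> g) = source C f \<odot> source C g" "target C (f \<otimes> g) = target C f \<odot> target C g"
  using tensor_hom[of f "source C f" "target C f" g "source C g" "target C g"]
  by (auto simp: hom_def)

lemma typing_symm [simp]: "source C (\<sigma> A B) = A \<odot> B" "target C (\<sigma> A B) = B \<odot> A"
  using symm_hom by (auto simp: hom_def)

lemma tensor_seq_tensor:
  "\<lbrakk>target C f = source C g; target C f' = source C g'\<rbrakk>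
    \<Longrightarrow> f \<otimes> f' ;; g \<otimes> g' = (f ;; g) \<otimes> (f' ;; g')"
  by (rule interchange[symmetric]) (simp_all add: hom_def)

text \<open>
  The hexagon with two unit objects makes \<open>\<sigma> A \<I>\<close> idempotent, and it is invertible.
\<close>

lemma symm_unit: "\<sigma> A \<I> = \<one> A"
proof -
  have idem: "\<sigma> A \<I> ;; \<sigma> A \<I> = \<sigma> A \<I>"
    using symm_hexagon[of A \<I> \<I>] by simp
  have "\<sigma> A \<I> = \<sigma> A \<I> ;; (\<sigma> A \<I> ;; \<sigma> \<I> A)"
    by (simp add: symm_inv)
  also have "\<dots> = \<sigma> A \<I> ;; \<sigma> A \<I> ;; \<sigma> \<I> A"
    by (simp add: seq_assoc')
  also have "\<dots> = \<one> A"
    by (simp add: idem symm_inv)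
  finally show ?thesis .
qed

lemma tensor_through_unit:
  assumes "f \<in> hom C A \<I>" "g \<in> hom C \<I> B"
  shows "f \<otimes> g = f ;; g" "g \<otimes> f = f ;; g"
proof -
  note [simp] = assms[THEN source_hom] assms[THEN target_hom]
  show "f \<otimes> g = f ;; g"
    using tensor_seq_tensor[of f "\<one> \<I>" "\<one> \<I>" g] by simp
  show "g \<otimes> f = f ;; g"
    using tensor_seq_tensor[of "\<one> \<I>" g f "\<one> \<I>"] by simp
qed

lemma middle_symm_nat:
  "(f \<otimes> f') \<otimes> (g \<otimes> g')
      ;; \<one> (target C f) \<otimes> \<sigma> (target C f') (target C g) \<otimes> \<one> (target C g')
    = \<one> (source C f) \<otimes> \<sigma> (source C f') (source C g) \<otimes> \<one> (source C g')
      ;; (f \<otimes> g) \<otimes> (f' \<otimes> g')"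
proof -
  have *: "f' \<otimes> g ;; \<sigma> (target C f') (target C g)
      = \<sigma> (source C f') (source C g) ;; g \<otimes> f'"
    by (rule symm_nat) (simp_all add: hom_def)
  have "f \<otimes> (f' \<otimes> g) \<otimes> g'
        ;; \<one> (target C f) \<otimes> \<sigma> (target C f') (target C g) \<otimes> \<one> (target C g')
      = f \<otimes> (\<sigma> (source C f') (source C g) ;; g \<otimes> f') \<otimes> g'"
    by (simp add: tensor_seq_tensor *)
  also have "\<dots> = \<one> (source C f) \<otimes> \<sigma> (source C f') (source C g) \<otimes> \<one> (source C g')
      ;; f \<otimes> (g \<otimes> f') \<otimes> g'"
    by (simp add: tensor_seq_tensor)
  finally show ?thesis
    by (simp add: tensor_assoc)
qed

end

context coalgebra_modality
begin

lemma typing_F [simp]: "source C (F f) = T (source C f)" "target C (F f) = T (target C f)"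
  using F_hom[of f "source C f" "target C f"] by (auto simp: hom_def)

lemmas typing_modality [simp] =
  \<delta>_hom[THEN source_hom] \<delta>_hom[THEN target_hom] \<epsilon>_hom[THEN source_hom] \<epsilon>_hom[THEN target_hom]
  \<Delta>_hom[THEN source_hom] \<Delta>_hom[THEN target_hom] e_hom[THEN source_hom] e_hom[THEN target_hom]

lemma F_seq': "target C f = source C g \<Longrightarrow> F f ;; F g = F (f ;; g)"
  by (rule F_seq[symmetric]) (simp_all add: hom_def)

lemma F_\<delta>: "target C f = A \<Longrightarrow> F f ;; \<delta> A = \<delta> (source C f) ;; F (F f)"
  and F_\<epsilon>: "target C f = A \<Longrightarrow> F f ;; \<epsilon> A = \<epsilon> (source C f) ;; f"
  and F_\<Delta>: "target C f = A \<Longrightarrow> F f ;; \<Delta> A = \<Delta> (source C f) ;; F f \<otimes> F f"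
  and F_e: "target C f = A \<Longrightarrow> F f ;; e A = e (source C f)"
  by (rule \<delta>_nat \<epsilon>_nat \<Delta>_nat e_nat; simp add: hom_def)+

end

section \<open>Uniqueness over a fixed monoidal structure\<close>

context additive_symmetric_monoidal_category
begin

text \<open>
  Taking the unit object as the second factor makes \<open>\<one> A \<otimes> \<eta> \<I> ;; \<one> A \<otimes> \<epsilon> \<I>\<close> and
  \<open>\<eta>' A \<otimes> \<one> \<I> ;; \<epsilon> A \<otimes> \<one> \<I>\<close> both equal to \<open>\<one> A\<close>. What remains of \<open>\<eta>' A \<otimes> \<eta> \<I> ;; m A \<I>\<close>
  is \<open>\<eta>' A\<close> if \<open>\<eta>'\<close> is moved through \<open>m\<close> and \<open>\<eta> A\<close> if \<open>\<eta>\<close> is.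
\<close>

lemma codereliction_unique:
  assumes \<epsilon>: "\<And>A. \<epsilon> A \<in> hom C (T A) A"
    and m: "\<And>A B. m A B \<in> hom C (T A \<odot> T B) (T (A \<odot> B))"
    and laws: "codereliction_laws C T F \<delta> \<epsilon> \<Delta> e m nab u \<eta>"
    and laws': "codereliction_laws C T F \<delta> \<epsilon> \<Delta> e m nab' u' \<eta>'"
  shows "\<eta> = \<eta>'"
proof
  fix A
  interpret D: codereliction_laws C T F \<delta> \<epsilon> \<Delta> e m nab u \<eta> by (fact laws)
  interpret D': codereliction_laws C T F \<delta> \<epsilon> \<Delta> e m nab' u' \<eta>' by (fact laws')
  note [simp] = D.\<eta>_hom[THEN source_hom] D.\<eta>_hom[THEN target_hom]
    D'.\<eta>_hom[THEN source_hom] D'.\<eta>_hom[THEN target_hom]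
    \<epsilon>[THEN source_hom] \<epsilon>[THEN target_hom] m[THEN source_hom] m[THEN target_hom]
  have "\<eta> A = \<eta>' A ;; \<epsilon> A ;; \<eta> A"
    by (simp add: D'.\<eta>_\<epsilon>)
  also have "\<dots> = \<eta>' A ;; (\<epsilon> A \<otimes> \<one> \<I> ;; \<eta> (A \<odot> \<I>))"
    by (simp add: seq_assoc')
  also have "\<dots> = \<eta>' A \<otimes> \<one> \<I> ;; (\<one> (T A) \<otimes> \<eta> \<I> ;; m A \<I>)"
    by (simp only: D.\<eta>_m_right tensor_unit)
  also have "\<dots> = \<eta>' A \<otimes> \<one> \<I> ;; \<one> (T A) \<otimes> \<eta> \<I> ;; m A \<I>"
    by (rule seq_assoc'[symmetric]) simp_all
  also have "\<dots> = \<one> A \<otimes> \<eta> \<I> ;; \<eta>' A \<otimes> \<one> (T \<I>) ;; m A \<I>"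
    by (simp only: tensor_seq_tensor typing_ident D.\<eta>_hom[THEN source_hom]
        D.\<eta>_hom[THEN target_hom] D'.\<eta>_hom[THEN source_hom] D'.\<eta>_hom[THEN target_hom]) simp
  also have "\<dots> = \<one> A \<otimes> \<eta> \<I> ;; (\<eta>' A \<otimes> \<one> (T \<I>) ;; m A \<I>)"
    by (rule seq_assoc') simp_all
  also have "\<dots> = \<one> A \<otimes> \<eta> \<I> ;; (\<one> A \<otimes> \<epsilon> \<I> ;; \<eta>' (A \<odot> \<I>))"
    by (simp only: D'.\<eta>_m_left)
  also have "\<dots> = \<one> A \<otimes> \<eta> \<I> ;; \<one> A \<otimes> \<epsilon> \<I> ;; \<eta>' A"
    by (simp add: seq_assoc')
  also have "\<dots> = \<eta>' A"
    by (simp add: tensor_seq_tensor D.\<eta>_\<epsilon>)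
  finally show "\<eta> A = \<eta>' A" .
qed

end

section \<open>The multiplication and unit determine the monoidal structure\<close>

context bialgebra_modality
begin

lemmas typing_bialgebra [simp] =
  nab_hom[THEN source_hom] nab_hom[THEN target_hom] u_hom[THEN source_hom] u_hom[THEN target_hom]

text \<open>
  By the bimonoid law \<open>\<nabla>\<close> is a comonoid map out of the tensor comonoid, whose comultiplication
  appears on the right hand side.
\<close>

lemma nab_comonoid_map:
  assumes a: "a \<in> hom C (T A) (T X)" "a ;; \<Delta> X = \<Delta> A ;; a \<otimes> a"
    and b: "b \<in> hom C (T B) (T X)" "b ;; \<Delta> X = \<Delta> B ;; b \<otimes> b"
  shows "a \<otimes> b ;; \<nabla> X ;; \<Delta> X
    = \<Delta> A \<otimes> \<Delta> B ;; \<one> (T A) \<otimes> \<sigma> (T A) (T B) \<otimes> \<one> (T B)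
      ;; (a \<otimes> b ;; \<nabla> X) \<otimes> (a \<otimes> b ;; \<nabla> X)"
proof -
  note [simp] = a(1)[THEN source_hom] a(1)[THEN target_hom]
    b(1)[THEN source_hom] b(1)[THEN target_hom]
  have "a \<otimes> b ;; \<nabla> X ;; \<Delta> X = a \<otimes> b ;; \<Delta> X \<otimes> \<Delta> X
      ;; (\<one> (T X) \<otimes> \<sigma> (T X) (T X) \<otimes> \<one> (T X) ;; \<nabla> X \<otimes> \<nabla> X)"
    by (simp add: seq_assoc' nab_\<Delta>)
  also have "\<dots> = \<Delta> A \<otimes> \<Delta> B ;; ((a \<otimes> a) \<otimes> (b \<otimes> b)
      ;; \<one> (T X) \<otimes> \<sigma> (T X) (T X) \<otimes> \<one> (T X)) ;; \<nabla> X \<otimes> \<nabla> X"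
    by (simp add: tensor_seq_tensor[of a] a(2) b(2))
      (simp add: seq_assoc' tensor_seq_tensor[symmetric])
  also have "\<dots> = \<Delta> A \<otimes> \<Delta> B ;; (\<one> (T A) \<otimes> \<sigma> (T A) (T B) \<otimes> \<one> (T B)
      ;; (a \<otimes> b) \<otimes> (a \<otimes> b)) ;; \<nabla> X \<otimes> \<nabla> X"
    using middle_symm_nat[of a a b b] by simp
  also have "\<dots> = \<Delta> A \<otimes> \<Delta> B ;; \<one> (T A) \<otimes> \<sigma> (T A) (T B) \<otimes> \<one> (T B)
      ;; ((a \<otimes> b) \<otimes> (a \<otimes> b) ;; \<nabla> X \<otimes> \<nabla> X)"
    by (simp add: seq_assoc')
  finally show ?thesis
    by (simp add: tensor_seq_tensor)
qed

end

context additive_symmetric_monoidal_category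
begin

lemma typing_zero [simp]: "source C (\<zero> A B) = A" "target C (\<zero> A B) = B"
  using zero_hom by (auto simp: hom_def)

lemma typing_plus [simp]:
  assumes "source C f = source C g" "target C f = target C g"
  shows "source C (f \<oplus> g) = source C g" "target C (f \<oplus> g) = target C g"
  using plus_hom[of f "source C g" "target C g" g] assms by (auto simp: hom_def)

lemma seq_plus': "\<lbrakk>target C f = source C g; source C g = source C h; target C g = target C h\<rbrakk>
    \<Longrightarrow> f ;; (g \<oplus> h) = f ;; g \<oplus> f ;; h"
  by (rule seq_plus) (simp_all add: hom_def)

lemma plus_seq': "\<lbrakk>source C g = source C h; target C g = target C h; target C h = source C k\<rbrakk>
    \<Longrightarrow> (g \<oplus> h) ;; k = g ;; k \<oplus> h ;; k"
  by (rule plus_seq) (simp_all add: hom_def)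

lemma plus_zero: "f \<in> hom C A B \<Longrightarrow> f \<oplus> \<zero> A B = f"
  using plus_comm zero_hom zero_plus by metis

lemma tensor_zero': "f \<otimes> \<zero> A B = \<zero> (source C f \<odot> A) (target C f \<odot> B)"
  by (rule tensor_zero) (simp add: hom_def)

lemma zero_tensor': "\<zero> A B \<otimes> f = \<zero> (A \<odot> source C f) (B \<odot> target C f)"
  by (rule zero_tensor) (simp add: hom_def)

end

context additive_bialgebra_modality
begin

text \<open>
  If \<open>T A\<close> and \<open>T B\<close> have a biproduct, \<open>\<nabla>\<close> gives an isomorphism from \<open>T (T A) \<odot> T (T B)\<close> to
  \<open>T\<close> of that biproduct. The arrow below is \<open>\<delta> A \<otimes> \<delta> B\<close>, followed by this isomorphism and by \<open>F\<close>
  of the copairing of the two insertions of the unit, written without mentioning a biproduct.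
\<close>

definition collect :: "'o \<Rightarrow> 'o \<Rightarrow> 'a"
  where "collect A B = (\<delta> A ;; F (\<one> (T A) \<otimes> u B)) \<otimes> (\<delta> B ;; F (u A \<otimes> \<one> (T B)))
    ;; \<nabla> (T A \<odot> T B)"

definition separate :: "'o \<Rightarrow> 'o \<Rightarrow> 'a"
  where "separate A B = \<Delta> (T A \<odot> T B)
    ;; (\<epsilon> (T A \<odot> T B) ;; \<epsilon> A \<otimes> e B) \<otimes> (\<epsilon> (T A \<odot> T B) ;; e A \<otimes> \<epsilon> B)"

lemma typing_collect [simp]:
  "source C (collect A B) = T A \<odot> T B" "target C (collect A B) = T (T A \<odot> T B)"
  by (simp_all add: collect_def)

lemma typing_separate [simp]:
  "source C (separate A B) = T (T A \<odot> T B)" "target C (separate A B) = A \<odot> B"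
  by (simp_all add: separate_def)

lemma collect_\<Delta>:
  "collect A B ;; \<Delta> (T A \<odot> T B)
    = \<Delta> A \<otimes> \<Delta> B ;; \<one> (T A) \<otimes> \<sigma> (T A) (T B) \<otimes> \<one> (T B) ;; collect A B \<otimes> collect A B"
proof -
  have *: "\<delta> D ;; F f ;; \<Delta> X = \<Delta> D ;; (\<delta> D ;; F f) \<otimes> (\<delta> D ;; F f)"
    if "f \<in> hom C (T D) X" for D f X
  proof -
    note [simp] = that[THEN source_hom] that[THEN target_hom]
    have "\<delta> D ;; F f ;; \<Delta> X = \<delta> D ;; \<Delta> (T D) ;; F f \<otimes> F f"
      by (simp add: seq_assoc' F_\<Delta>)
    also have "\<dots> = \<Delta> D ;; \<delta> D \<otimes> \<delta> D ;; F f \<otimes> F f"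
      by (simp add: \<delta>_\<Delta>)
    also have "\<dots> = \<Delta> D ;; (\<delta> D \<otimes> \<delta> D ;; F f \<otimes> F f)"
      by (simp add: seq_assoc')
    finally show ?thesis
      by (simp add: tensor_seq_tensor)
  qed
  show ?thesis
    unfolding collect_def by (rule nab_comonoid_map; (rule *)?; simp add: hom_def)
qed

text \<open>
  The law for \<open>\<nabla> ;; \<epsilon>\<close> gives one summand for each insertion; in each of them the other
  insertion is discarded by \<open>e\<close>.
\<close>

lemma collect_\<epsilon>:
  "collect A B ;; \<epsilon> (T A \<odot> T B)
    = (e A ;; u A) \<otimes> \<one> (T B) \<oplus> \<one> (T A) \<otimes> (e B ;; u B)"
proof -
  let ?X = "T A \<odot> T B"
  let ?a = "\<delta> A ;; F (\<one> (T A) \<otimes> u B)" and ?b = "\<delta> B ;; F (u A \<otimes> \<one> (T B))"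
  have \<epsilon>: "\<delta> D ;; F f ;; \<epsilon> X = f" if "f \<in> hom C (T D) X" for D f X
  proof -
    note [simp] = that[THEN source_hom] that[THEN target_hom]
    have "\<delta> D ;; F f ;; \<epsilon> X = \<delta> D ;; \<epsilon> (T D) ;; f"
      by (simp add: seq_assoc' F_\<epsilon>)
    then show ?thesis by (simp add: \<delta>_\<epsilon>)
  qed
  have e: "\<delta> D ;; F f ;; e X = e D" if "f \<in> hom C (T D) X" for D f X
  proof -
    note [simp] = that[THEN source_hom] that[THEN target_hom]
    show ?thesis by (simp add: seq_assoc' F_e \<delta>_e)
  qed
  have "collect A B ;; \<epsilon> ?X = ?a \<otimes> ?b ;; (e ?X \<otimes> \<epsilon> ?X \<oplus> \<epsilon> ?X \<otimes> e ?X)"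
    by (simp add: collect_def seq_assoc' nab_\<epsilon>)
  also have "\<dots> = ?a \<otimes> ?b ;; e ?X \<otimes> \<epsilon> ?X \<oplus> ?a \<otimes> ?b ;; \<epsilon> ?X \<otimes> e ?X"
    by (rule seq_plus') simp_all
  also have "\<dots> = (?a ;; e ?X) \<otimes> (?b ;; \<epsilon> ?X) \<oplus> (?a ;; \<epsilon> ?X) \<otimes> (?b ;; e ?X)"
    by (simp add: tensor_seq_tensor)
  also have "\<dots> = e A \<otimes> (u A \<otimes> \<one> (T B)) \<oplus> (\<one> (T A) \<otimes> u B) \<otimes> e B"
    by (simp add: \<epsilon> e hom_def)
  also have "\<dots> = (e A ;; u A) \<otimes> \<one> (T B) \<oplus> \<one> (T A) \<otimes> (e B ;; u B)"
    by (simp add: tensor_assoc tensor_through_unit(2)[OF e_hom u_hom]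
        tensor_through_unit(1)[OF e_hom u_hom, symmetric])
  finally show ?thesis .
qed

text \<open>
  The comultiplication sends one copy of \<open>collect A B\<close> to each projection, where the summand
  aimed at the other factor dies by \<open>u ;; \<epsilon> = \<zero>\<close>.
\<close>

lemma collect_separate: "collect A B ;; separate A B = \<epsilon> A \<otimes> \<epsilon> B"
proof -
  let ?X = "T A \<odot> T B"
  have zero: "e D ;; u D ;; \<epsilon> D = \<zero> (T D) D" for D
    by (simp add: seq_assoc' u_\<epsilon> seq_zero[OF e_hom])
  have eue: "e D ;; u D ;; e D = e D" for D
    by (simp add: seq_assoc' u_e)
  have left: "collect A B ;; (\<epsilon> ?X ;; \<epsilon> A \<otimes> e B) = \<epsilon> A \<otimes> e B"
  proof -
    have "collect A B ;; (\<epsilon> ?X ;; \<epsilon> A \<otimes> e B)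
        = ((e A ;; u A) \<otimes> \<one> (T B) \<oplus> \<one> (T A) \<otimes> (e B ;; u B)) ;; \<epsilon> A \<otimes> e B"
      by (simp add: seq_assoc'[symmetric] collect_\<epsilon>)
    also have "\<dots> = \<zero> (T A \<odot> T B) A \<oplus> \<epsilon> A \<otimes> e B"
      by (simp add: plus_seq' tensor_seq_tensor zero eue zero_tensor')
    finally show ?thesis
      by (simp add: zero_plus hom_def)
  qed
  have right: "collect A B ;; (\<epsilon> ?X ;; e A \<otimes> \<epsilon> B) = e A \<otimes> \<epsilon> B"
  proof -
    have "collect A B ;; (\<epsilon> ?X ;; e A \<otimes> \<epsilon> B)
        = ((e A ;; u A) \<otimes> \<one> (T B) \<oplus> \<one> (T A) \<otimes> (e B ;; u B)) ;; e A \<otimes> \<epsilon> B"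
      by (simp add: seq_assoc'[symmetric] collect_\<epsilon>)
    also have "\<dots> = e A \<otimes> \<epsilon> B \<oplus> \<zero> (T A \<odot> T B) B"
      by (simp add: plus_seq' tensor_seq_tensor zero eue tensor_zero')
    finally show ?thesis
      by (simp add: plus_zero hom_def)
  qed
  have "collect A B ;; separate A B
      = collect A B ;; \<Delta> ?X ;; (\<epsilon> ?X ;; \<epsilon> A \<otimes> e B) \<otimes> (\<epsilon> ?X ;; e A \<otimes> \<epsilon> B)"
    by (simp add: separate_def seq_assoc')
  also have "\<dots> = \<Delta> A \<otimes> \<Delta> B ;; (\<one> (T A) \<otimes> \<sigma> (T A) (T B) \<otimes> \<one> (T B)
      ;; (\<epsilon> A \<otimes> e B) \<otimes> (e A \<otimes> \<epsilon> B))"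
    by (simp add: collect_\<Delta> seq_assoc' tensor_seq_tensor[of "collect A B"] left right)
  also have "\<dots> = \<Delta> A \<otimes> \<Delta> B ;; (\<epsilon> A \<otimes> e A) \<otimes> (e B \<otimes> \<epsilon> B)"
    using middle_symm_nat[of "\<epsilon> A" "e A" "e B" "\<epsilon> B"] by (simp add: symm_unit tensor_ident)
  also have "\<dots> = \<Delta> A \<otimes> \<Delta> B ;; (\<one> (T A) \<otimes> e A) \<otimes> (e B \<otimes> \<one> (T B)) ;; \<epsilon> A \<otimes> \<epsilon> B"
  proof -
    have "\<epsilon> A \<otimes> e A = \<one> (T A) \<otimes> e A ;; \<epsilon> A" "e B \<otimes> \<epsilon> B = e B \<otimes> \<one> (T B) ;; \<epsilon> B"
      using tensor_seq_tensor[of "\<one> (T A)" "\<epsilon> A" "e A" "\<one> \<I>"]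
        tensor_seq_tensor[of "e B" "\<one> \<I>" "\<one> (T B)" "\<epsilon> B"] by simp_all
    then show ?thesis
      by (simp add: seq_assoc' tensor_seq_tensor)
  qed
  also have "\<dots> = \<epsilon> A \<otimes> \<epsilon> B"
    by (simp add: tensor_seq_tensor \<Delta>_counit_left \<Delta>_counit_right)
  finally show ?thesis .
qed

end

locale additive_bialgebra_induced_by_monoidal =
  additive_bialgebra_modality C T F \<delta> \<epsilon> \<Delta> e nab u +
  monoidal_coalgebra_modality C T F \<delta> \<epsilon> \<Delta> e m m\<^sub>I
  for C :: "('o, 'a, 'x) additive_smc_scheme" (structure)
    and T F \<delta> \<epsilon> \<Delta> e and nab ("\<nabla>") and u m m\<^sub>I +
  assumes nab_induced: "\<nabla> = induced_mult C T F \<delta> \<epsilon> e m"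
begin

lemmas typing_m [simp] = m_hom[THEN source_hom] m_hom[THEN target_hom]

text \<open>
  The coalgebra structure of the tensor product of two cofree coalgebras.
\<close>

definition tensor_coalgebra :: "'o \<Rightarrow> 'o \<Rightarrow> 'a" ("\<gamma>")
  where "\<gamma> A B = \<delta> A \<otimes> \<delta> B ;; m (T A) (T B)"

lemma typing_tensor_coalgebra [simp]:
  "source C (\<gamma> A B) = T A \<odot> T B" "target C (\<gamma> A B) = T (T A \<odot> T B)"
  by (simp_all add: tensor_coalgebra_def)

lemma tensor_F_m:
  "F f \<otimes> F g ;; m (target C f) (target C g) = m (source C f) (source C g) ;; F (f \<otimes> g)"
  by (rule m_nat) (simp_all add: hom_def)

lemma tensor_coalgebra_\<epsilon>: "\<gamma> A B ;; F (\<epsilon> A \<otimes> \<epsilon> B) = m A B"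
proof -
  have "\<gamma> A B ;; F (\<epsilon> A \<otimes> \<epsilon> B) = \<delta> A \<otimes> \<delta> B ;; (F (\<epsilon> A) \<otimes> F (\<epsilon> B) ;; m A B)"
    using tensor_F_m[of "\<epsilon> A" "\<epsilon> B"] by (simp add: tensor_coalgebra_def seq_assoc')
  also have "\<dots> = \<delta> A \<otimes> \<delta> B ;; F (\<epsilon> A) \<otimes> F (\<epsilon> B) ;; m A B"
    by (simp add: seq_assoc')
  finally show ?thesis
    by (simp add: tensor_seq_tensor \<delta>_F_\<epsilon> tensor_ident)
qed

text \<open>
  By naturality of \<open>m\<close>, the coalgebra structure \<open>\<gamma>\<close> is functorial in both factors.
\<close>

lemma tensor_coalgebra_map:
  assumes a: "a \<in> hom C (T A) (T A')" "a ;; \<delta> A' = \<delta> A ;; F a"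
    and b: "b \<in> hom C (T B) (T B')" "b ;; \<delta> B' = \<delta> B ;; F b"
  shows "a \<otimes> b ;; \<gamma> A' B' = \<gamma> A B ;; F (a \<otimes> b)"
proof -
  note [simp] = a(1)[THEN source_hom] a(1)[THEN target_hom]
    b(1)[THEN source_hom] b(1)[THEN target_hom]
  have "a \<otimes> b ;; \<gamma> A' B' = a \<otimes> b ;; \<delta> A' \<otimes> \<delta> B' ;; m (T A') (T B')"
    by (simp add: tensor_coalgebra_def seq_assoc')
  also have "\<dots> = \<delta> A \<otimes> \<delta> B ;; (F a \<otimes> F b ;; m (T A') (T B'))"
    by (simp add: tensor_seq_tensor a(2) b(2)) (simp add: tensor_seq_tensor[symmetric] seq_assoc')
  finally show ?thesis
    using tensor_F_m[of a b] by (simp add: tensor_coalgebra_def seq_assoc')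
qed

lemma tensor_coalgebra_coassoc: "\<gamma> A B ;; \<delta> (T A \<odot> T B) = \<gamma> A B ;; F (\<gamma> A B)"
proof -
  have "\<gamma> A B ;; \<delta> (T A \<odot> T B) = \<delta> A \<otimes> \<delta> B ;; \<gamma> (T A) (T B) ;; F (m (T A) (T B))"
    by (simp add: tensor_coalgebra_def seq_assoc' m_\<delta>)
  also have "\<delta> A \<otimes> \<delta> B ;; \<gamma> (T A) (T B) = \<gamma> A B ;; F (\<delta> A \<otimes> \<delta> B)"
    by (rule tensor_coalgebra_map) (simp_all add: hom_def \<delta>_\<delta>)
  also have "\<dots> ;; F (m (T A) (T B)) = \<gamma> A B ;; F (\<gamma> A B)"
    by (simp add: seq_assoc' F_seq' tensor_coalgebra_def[of A B])
  finally show ?thesis .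
qed

text \<open>
  The induced multiplication has the form \<open>\<gamma> ;; F s\<close>, and any such arrow is a coalgebra map.
\<close>

lemma nab_coalgebra_map: "\<nabla> A ;; \<delta> A = \<gamma> A A ;; F (\<nabla> A)"
proof -
  define s where "s = \<epsilon> A \<otimes> e A \<oplus> e A \<otimes> \<epsilon> A"
  have [simp]: "source C s = T A \<odot> T A" "target C s = A"
    by (simp_all add: s_def)
  have nab: "\<nabla> A = \<gamma> A A ;; F s"
    by (simp add: nab_induced induced_mult_def tensor_coalgebra_def s_def)
  have "\<nabla> A ;; \<delta> A = \<gamma> A A ;; \<delta> (T A \<odot> T A) ;; F (F s)"
    by (simp add: nab seq_assoc' F_\<delta>)
  also have "\<dots> = \<gamma> A A ;; F (\<gamma> A A ;; F s)"
    by (simp add: tensor_coalgebra_coassoc seq_assoc' F_seq')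
  finally show ?thesis
    by (simp add: nab)
qed

lemma collect_coalgebra_map:
  "collect A B ;; \<delta> (T A \<odot> T B) = \<gamma> A B ;; F (collect A B)"
proof -
  let ?X = "T A \<odot> T B"
  let ?ab = "(\<delta> A ;; F (\<one> (T A) \<otimes> u B)) \<otimes> (\<delta> B ;; F (u A \<otimes> \<one> (T B)))"
  have *: "\<delta> D ;; F f ;; \<delta> X = \<delta> D ;; F (\<delta> D ;; F f)" if "f \<in> hom C (T D) X" for D f X
  proof -
    note [simp] = that[THEN source_hom] that[THEN target_hom]
    have "\<delta> D ;; F f ;; \<delta> X = \<delta> D ;; \<delta> (T D) ;; F (F f)"
      by (simp add: seq_assoc' F_\<delta>)
    then show ?thesis
      by (simp add: \<delta>_\<delta> seq_assoc' F_seq')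
  qed
  have "?ab ;; \<gamma> ?X ?X = \<gamma> A B ;; F ?ab"
    by (rule tensor_coalgebra_map; (rule *)?; simp add: hom_def)
  then have "?ab ;; \<gamma> ?X ?X ;; F (\<nabla> ?X) = \<gamma> A B ;; F ?ab ;; F (\<nabla> ?X)"
    by simp
  then show ?thesis
    by (simp add: collect_def seq_assoc' nab_coalgebra_map F_seq')
qed

text \<open>
  As \<open>collect\<close> is a coalgebra map, \<open>\<delta>\<close> after it becomes \<open>\<gamma>\<close> before \<open>F\<close> of it, and \<open>\<gamma>\<close> extends
  \<open>\<epsilon> A \<otimes> \<epsilon> B\<close> to \<open>m A B\<close>. The right hand side is the same for all \<open>m\<close> that induce \<open>\<nabla>\<close>.
\<close>

lemma m_eq_collect_separate: "m A B = collect A B ;; \<delta> (T A \<odot> T B) ;; F (separate A B)"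
proof -
  have "collect A B ;; \<delta> (T A \<odot> T B) ;; F (separate A B)
      = \<gamma> A B ;; F (collect A B ;; separate A B)"
    by (simp add: collect_coalgebra_map seq_assoc' F_seq')
  then show ?thesis
    by (simp add: collect_separate tensor_coalgebra_\<epsilon>)
qed

end

lemma monoidal_structure_determined:
  assumes "additive_bialgebra_modality C T F \<delta> \<epsilon> \<Delta> e nab u"
    and "monoidal_coalgebra_modality C T F \<delta> \<epsilon> \<Delta> e m m\<^sub>I" "nab = induced_mult C T F \<delta> \<epsilon> e m"
    and "monoidal_coalgebra_modality C T F \<delta> \<epsilon> \<Delta> e m' m\<^sub>I'" "nab = induced_mult C T F \<delta> \<epsilon> e m'"
  shows "m = m'"
proof (intro ext)
  interpret M: additive_bialgebra_induced_by_monoidal C T F \<delta> \<epsilon> \<Delta> e nab u m m\<^sub>I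
    using assms by (intro additive_bialgebra_induced_by_monoidal.intro
        additive_bialgebra_induced_by_monoidal_axioms.intro)
  interpret M': additive_bialgebra_induced_by_monoidal C T F \<delta> \<epsilon> \<Delta> e nab u m' m\<^sub>I'
    using assms by (intro additive_bialgebra_induced_by_monoidal.intro
        additive_bialgebra_induced_by_monoidal_axioms.intro)
  show "m A B = m' A B" for A B
    by (simp only: M.m_eq_collect_separate M'.m_eq_collect_separate)
qed

section \<open>Uniqueness for the three kinds of modality\<close>

lemma codereliction_unique_over_coalgebra_modality:
  assumes "additive_symmetric_monoidal_category C"
    and "monoidal_coalgebra_modality C T F \<delta> \<epsilon> \<Delta> e m m\<^sub>I"
    and "codereliction_laws C T F \<delta> \<epsilon> \<Delta> e m nab u \<eta>"
    and "codereliction_laws C T F \<delta> \<epsilon> \<Delta> e m nab' u' \<eta>'"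
  shows "\<eta> = \<eta>'"
proof -
  interpret additive_symmetric_monoidal_category C by (fact assms(1))
  interpret monoidal_coalgebra_modality C T F \<delta> \<epsilon> \<Delta> e m m\<^sub>I by (fact assms(2))
  show ?thesis
    using \<epsilon>_hom m_hom assms(3,4) by (rule codereliction_unique)
qed

theorem theorem8p3:
  fixes C :: "('o, 'a) additive_smc"
    and T :: "'o \<Rightarrow> 'o" and F :: "'a \<Rightarrow> 'a"
    and \<delta> \<epsilon> \<Delta> e nab u :: "'o \<Rightarrow> 'a"
    and m :: "'o \<Rightarrow> 'o \<Rightarrow> 'a" and m\<^sub>I :: "'a"
  assumes "additive_symmetric_monoidal_category C"
  shows "(monoidal_coalgebra_modality C T F \<delta> \<epsilon> \<Delta> e m m\<^sub>I \<longrightarrow>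
            (\<exists>\<eta>. codereliction C T F \<delta> \<epsilon> \<Delta> e m m\<^sub>I \<eta>) \<longrightarrow>
            (\<exists>!\<eta>. codereliction C T F \<delta> \<epsilon> \<Delta> e m m\<^sub>I \<eta>))
       \<and> (additive_bialgebra_modality C T F \<delta> \<epsilon> \<Delta> e nab u \<longrightarrow>
            (\<exists>\<eta>. additive_bialgebra_codereliction C T F \<delta> \<epsilon> \<Delta> e nab u \<eta>) \<longrightarrow>
            (\<exists>!\<eta>. additive_bialgebra_codereliction C T F \<delta> \<epsilon> \<Delta> e nab u \<eta>))
       \<and> (monoidal_bialgebra_modality C T F \<delta> \<epsilon> \<Delta> e m m\<^sub>I nab u \<longrightarrow>
            (\<exists>\<eta>. monoidal_bialgebra_codereliction C T F \<delta> \<epsilon> \<Delta> e m nab u \<eta>) \<longrightarrow>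
            (\<exists>!\<eta>. monoidal_bialgebra_codereliction C T F \<delta> \<epsilon> \<Delta> e m nab u \<eta>))"
proof (intro conjI impI)
  assume mcm: "monoidal_coalgebra_modality C T F \<delta> \<epsilon> \<Delta> e m m\<^sub>I"
    and ex: "\<exists>\<eta>. codereliction C T F \<delta> \<epsilon> \<Delta> e m m\<^sub>I \<eta>"
  show "\<exists>!\<eta>. codereliction C T F \<delta> \<epsilon> \<Delta> e m m\<^sub>I \<eta>"
    using ex codereliction_unique_over_coalgebra_modality[OF assms mcm]
    unfolding codereliction_def by blast
next
  assume abm: "additive_bialgebra_modality C T F \<delta> \<epsilon> \<Delta> e nab u"
    and ex: "\<exists>\<eta>. additive_bialgebra_codereliction C T F \<delta> \<epsilon> \<Delta> e nab u \<eta>"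
  have "\<eta> = \<eta>'"
    if "additive_bialgebra_codereliction C T F \<delta> \<epsilon> \<Delta> e nab u \<eta>"
      and "additive_bialgebra_codereliction C T F \<delta> \<epsilon> \<Delta> e nab u \<eta>'" for \<eta> \<eta>'
  proof -
    from that obtain n n\<^sub>I n' n\<^sub>I' where
      n: "monoidal_coalgebra_modality C T F \<delta> \<epsilon> \<Delta> e n n\<^sub>I" "nab = induced_mult C T F \<delta> \<epsilon> e n"
        "codereliction C T F \<delta> \<epsilon> \<Delta> e n n\<^sub>I \<eta>" and
      n': "monoidal_coalgebra_modality C T F \<delta> \<epsilon> \<Delta> e n' n\<^sub>I'" "nab = induced_mult C T F \<delta> \<epsilon> e n'"
        "codereliction C T F \<delta> \<epsilon> \<Delta> e n' n\<^sub>I' \<eta>'"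
      unfolding additive_bialgebra_codereliction_def by blast
    have "n' = n"
      using monoidal_structure_determined[OF abm n'(1,2) n(1,2)] .
    then show ?thesis
      using codereliction_unique_over_coalgebra_modality[OF assms n(1)] n(3) n'(3)
      unfolding codereliction_def by blast
  qed
  with ex show "\<exists>!\<eta>. additive_bialgebra_codereliction C T F \<delta> \<epsilon> \<Delta> e nab u \<eta>"
    by blast
next
  assume mbm: "monoidal_bialgebra_modality C T F \<delta> \<epsilon> \<Delta> e m m\<^sub>I nab u"
    and ex: "\<exists>\<eta>. monoidal_bialgebra_codereliction C T F \<delta> \<epsilon> \<Delta> e m nab u \<eta>"
  show "\<exists>!\<eta>. monoidal_bialgebra_codereliction C T F \<delta> \<epsilon> \<Delta> e m nab u \<eta>"
    using ex codereliction_unique_over_coalgebra_modality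
      [OF assms monoidal_bialgebra_modality.axioms(1)[OF mbm]]
    unfolding monoidal_bialgebra_codereliction_def by blast
qed

end
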